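(* Let $T_n$ be a strongly connected arc-colored tournament of order $n$ with $\Delta^{-mon}(T_n)\leq\Delta^{+mon}(T_n)$. If $n$ is odd and $$\Delta^{-mon}(T_{n})<\frac{n^{2}+n-3\,i(T_{n})^{2}}{12n},$$ or $n$ is even and $$\Delta^{-mon}(T_{n})<\frac{n^{2}-1-3\,i(T_{n})^{2}}{12(n-1)},$$ then there exists a rainbow triangle in $T_n$.
   Context: All digraphs are finite and simple. A tournament $T_n$ of order $n$ is a digraph on $n$ vertices in which each pair of distinct vertices is joined by precisely one arc. For a vertex $v$, $d^-(v)$ and $d^+(v)$ denote its indegree and outdegree. The irregularity is $i(T_n)=\max_{v}|d^+(v)-d^-(v)|$, the maximum being over all vertices $v$ of $T_n$. A digraph is strongly connected if for every pair of distinct vertices $u,v$ there is a directed path from $u$ to $v$. An arc-coloring is an arbitrary map from the arc set to $\mathbb{N}$, the set of natural numbers; an arc-colored tournament is a tournament equipped with an arc-coloring. $\Delta^{-mon}(T_n)$ (resp. $\Delta^{+mon}(T_n)$) is the maximum number of in-arcs (resp. out-arcs) of a same color incident to a vertex of $T_n$, the maximum being over all vertices and all colors. A triangle means a directed cycle of length $3$; it is rainbow if its three arcs have pairwise distinct colors.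
   Formalization: The formal statement adds the assumption n ≥ 2; for n = 1 the claim fails, since the one-vertex tournament is strongly connected with irregularity and monochromatic degrees 0 and 0 < 1/6, but it contains no triangle. *)

theory Defs
  imports Complex_Main "Graph_Theory.Digraph_Component"
begin

locale tournament = digraph +
  assumes ex1_arc: "\<lbrakk>u \<in> verts G; v \<in> verts G; u \<noteq> v\<rbrakk>
    \<Longrightarrow> \<exists>!e. e \<in> arcs G \<and> {tail G e, head G e} = {u, v}"

definition irregularity :: "('a, 'b) pre_digraph \<Rightarrow> int" where
  "irregularity T = Max {\<bar>int (out_degree T v) - int (in_degree T v)\<bar> | v. v \<in> verts T}"

text \<open>An arc-coloring is a total function on the arc type; only its values on the arcs of the
  digraph matter. Both sets below are finite for finite digraphs, since their elements are bounded
  by the number of arcs. In a one-vertex digraph, which is strongly connected, both maxima are 0.\<close>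

definition max_mono_in :: "('a, 'b) pre_digraph \<Rightarrow> ('b \<Rightarrow> nat) \<Rightarrow> nat" where
  "max_mono_in T col = Max {card {e \<in> in_arcs T v. col e = k} | v k. v \<in> verts T}"

definition max_mono_out :: "('a, 'b) pre_digraph \<Rightarrow> ('b \<Rightarrow> nat) \<Rightarrow> nat" where
  "max_mono_out T col = Max {card {e \<in> out_arcs T v. col e = k} | v k. v \<in> verts T}"

definition dir_triangle :: "('a, 'b) pre_digraph \<Rightarrow> 'b list \<Rightarrow> bool" where
  "dir_triangle T p \<longleftrightarrow> pre_digraph.cycle T p \<and> length p = 3"

definition rainbow :: "('b \<Rightarrow> nat) \<Rightarrow> 'b list \<Rightarrow> bool" where
  "rainbow col p \<longleftrightarrow> distinct (map col p)"

end

theory Submission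
  imports Defs
begin

text \<open>
  The proof counts ordered cyclic triples, that is, triples \<open>(u, v, w)\<close> with arcs
  \<open>u \<rightarrow> v \<rightarrow> w \<rightarrow> u\<close>; every directed triangle yields three of them.

  Let \<open>e v\<close> be the outdegree minus the indegree of \<open>v\<close>. Lemma \<open>card_cyclic_triples\<close> evaluates their
  number as \<open>(n (n\<^sup>2 - 1) - 3 \<Sum> (e v)\<^sup>2) / 8\<close>: among the directed 2-paths one discards the transitive
  ones, and the number of transitive triples is determined by the scores.

  If no triangle is rainbow, every triangle contains two consecutive arcs \<open>u \<rightarrow> v \<rightarrow> w\<close> of the same
  colour. Fixing the second of them leaves at most \<open>\<Delta>\<close> choices for the first, where \<open>\<Delta>\<close> is the
  maximal number of in-arcs of one colour at a vertex. So there are at most \<open>\<Delta> n (n - 1) / 2\<close>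
  triangles (\<open>card_cyclic_triples_le\<close>), and together
  \<open>n (n\<^sup>2 - 1) - 3 \<Sum> (e v)\<^sup>2 \<le> 12 \<Delta> n (n - 1)\<close>.

  It remains to bound the sum of squares by the irregularity \<open>i\<close>. The trivial bound \<open>n i\<^sup>2\<close> gives the
  even case. For odd \<open>n\<close> the numbers \<open>e v\<close>, which lie in \<open>[-i, i]\<close> and sum to zero, cannot all be
  extremal, and the bound improves to \<open>(n - 1) i\<^sup>2\<close> (\<open>sum_squares_le_odd\<close>); this accounts for the
  different threshold.
\<close>

section \<open>Counting cyclic triples by scores\<close>

text \<open>With \<open>a\<close> the adjacency matrix, the cyclic triples are those 2-paths \<open>u \<rightarrow> v \<rightarrow> w\<close> that are not
  closed up by \<open>u \<rightarrow> w\<close>. A transitive triple is obtained from its source by picking an ordered pair of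
  out-neighbours in one of the two orders, and likewise from its sink; averaging both
  evaluations leaves an expression in the scores alone.\<close>

lemma sum_cyclic_products:
  fixes a :: "'a \<Rightarrow> 'a \<Rightarrow> int"
  assumes fin: "finite V"
    and idem: "\<And>u v. a u v * a u v = a u v"
    and tour: "\<And>u v. u \<in> V \<Longrightarrow> v \<in> V \<Longrightarrow> a u v + a v u = of_bool (u \<noteq> v)"
  defines "dout \<equiv> \<lambda>u. \<Sum>v\<in>V. a u v" and "din \<equiv> \<lambda>v. \<Sum>u\<in>V. a u v"
  shows "8 * (\<Sum>u\<in>V. \<Sum>v\<in>V. \<Sum>w\<in>V. a u v * a v w * a w u)
    = int (card V) * ((int (card V))\<^sup>2 - 1) - 3 * (\<Sum>v\<in>V. (dout v - din v)\<^sup>2)"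
proof -
  define C where "C = (\<Sum>u\<in>V. \<Sum>v\<in>V. \<Sum>w\<in>V. a u v * a v w * a w u)"
  define t where "t = (\<Sum>u\<in>V. \<Sum>v\<in>V. \<Sum>w\<in>V. a u v * a v w * a u w)"
  have no_digon: "a u v * a v u = 0" if "u \<in> V" "v \<in> V" for u v
  proof -
    have "a v u = of_bool (u \<noteq> v) - a u v" using tour[OF that] by simp
    moreover have "a u u = 0" using tour[OF that(1) that(1)] by simp
    ultimately show ?thesis using idem[of u v] by (cases "u = v") (auto simp: algebra_simps)
  qed
  have paths: "C + t = (\<Sum>v\<in>V. din v * dout v)"
  proof -
    have "C + t = (\<Sum>u\<in>V. \<Sum>v\<in>V. \<Sum>w\<in>V. a u v * a v w * (a w u + a u w))"
      by (simp add: C_def t_def sum.distrib distrib_left)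
    also have "\<dots> = (\<Sum>u\<in>V. \<Sum>v\<in>V. \<Sum>w\<in>V. a u v * a v w)"
    proof (intro sum.cong refl)
      fix u v w assume "u \<in> V" "v \<in> V" "w \<in> V"
      then show "a u v * a v w * (a w u + a u w) = a u v * a v w"
        using no_digon[of u v] by (cases "u = w") (auto simp: tour)
    qed
    also have "\<dots> = (\<Sum>v\<in>V. \<Sum>u\<in>V. \<Sum>w\<in>V. a u v * a v w)"
      by (rule sum.swap)
    also have "\<dots> = (\<Sum>v\<in>V. din v * dout v)"
      by (simp add: din_def dout_def sum_product)
    finally show ?thesis .
  qed
  have sources: "2 * t = (\<Sum>u\<in>V. (dout u)\<^sup>2 - dout u)"
  proof -
    have t': "t = (\<Sum>u\<in>V. \<Sum>v\<in>V. \<Sum>w\<in>V. a u v * a u w * a v w)"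
      by (simp add: t_def mult.commute mult.left_commute)
    have "t = (\<Sum>u\<in>V. \<Sum>v\<in>V. \<Sum>w\<in>V. a u v * a u w * a w v)"
      unfolding t' by (rule sum.cong[OF refl], subst sum.swap) (simp add: mult.commute)
    with t' have "2 * t = (\<Sum>u\<in>V. \<Sum>v\<in>V. \<Sum>w\<in>V. a u v * a u w * (a v w + a w v))"
      by (simp add: sum.distrib distrib_left)
    also have "\<dots> = (\<Sum>u\<in>V. \<Sum>v\<in>V. \<Sum>w\<in>V. a u v * a u w - (if w = v then a u v else 0))"
      by (intro sum.cong refl) (auto simp: tour idem)
    also have "\<dots> = (\<Sum>u\<in>V. (dout u)\<^sup>2 - dout u)"
      by (simp add: sum_subtractf fin dout_def power2_eq_square sum_product)
    finally show ?thesis .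
  qed
  have sinks: "2 * t = (\<Sum>w\<in>V. (din w)\<^sup>2 - din w)"
  proof -
    have "t = (\<Sum>u\<in>V. \<Sum>w\<in>V. \<Sum>v\<in>V. a u w * a v w * a u v)"
      unfolding t_def by (rule sum.cong[OF refl], subst sum.swap) (simp add: mult_ac)
    also have "\<dots> = (\<Sum>w\<in>V. \<Sum>u\<in>V. \<Sum>v\<in>V. a u w * a v w * a u v)"
      by (rule sum.swap)
    finally have t': "t = (\<Sum>w\<in>V. \<Sum>u\<in>V. \<Sum>v\<in>V. a u w * a v w * a u v)" .
    have "t = (\<Sum>w\<in>V. \<Sum>u\<in>V. \<Sum>v\<in>V. a u w * a v w * a v u)"
      unfolding t' by (rule sum.cong[OF refl], subst sum.swap) (simp add: mult.commute)
    with t' have "2 * t = (\<Sum>w\<in>V. \<Sum>u\<in>V. \<Sum>v\<in>V. a u w * a v w * (a u v + a v u))"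
      by (simp add: sum.distrib distrib_left)
    also have "\<dots> = (\<Sum>w\<in>V. \<Sum>u\<in>V. \<Sum>v\<in>V. a u w * a v w - (if v = u then a u w else 0))"
      by (intro sum.cong refl) (auto simp: tour idem)
    also have "\<dots> = (\<Sum>w\<in>V. (din w)\<^sup>2 - din w)"
      by (simp add: sum_subtractf fin din_def power2_eq_square sum_product)
    finally show ?thesis .
  qed
  have score: "dout v = int (card V) - 1 - din v" if "v \<in> V" for v
  proof -
    have "dout v + din v = (\<Sum>u\<in>V. of_bool (v \<noteq> u))"
      unfolding dout_def din_def sum.distrib[symmetric] using that by (intro sum.cong) (auto simp: tour)
    also have "\<dots> = (\<Sum>u\<in>V. 1 - (if u = v then 1 else 0))"
      by (intro sum.cong) auto
    also have "\<dots> = int (card V) - 1"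
      using that fin by (simp add: sum_subtractf)
    finally show ?thesis by simp
  qed
  \<comment> \<open>Using the two values of \<open>t\<close> equally makes the summand symmetric in \<open>din\<close> and \<open>dout\<close>, so that
    it depends only on their difference once their sum is fixed.\<close>
  have "8 * C = 8 * (C + t) - 2 * (2 * t) - 2 * (2 * t)" by simp
  also have "\<dots> = (\<Sum>v\<in>V. 8 * (din v * dout v) - 2 * ((dout v)\<^sup>2 - dout v) - 2 * ((din v)\<^sup>2 - din v))"
    unfolding paths
    by (subst sources, subst sinks) (simp add: sum_subtractf sum.distrib sum_distrib_left sum_distrib_right algebra_simps)
  also have "\<dots> = (\<Sum>v\<in>V. ((int (card V))\<^sup>2 - 1) - 3 * (dout v - din v)\<^sup>2)"
    by (intro sum.cong refl) (simp add: score power2_eq_square algebra_simps)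
  also have "\<dots> = int (card V) * ((int (card V))\<^sup>2 - 1) - 3 * (\<Sum>v\<in>V. (dout v - din v)\<^sup>2)"
    by (simp add: sum_subtractf sum_distrib_left)
  finally show ?thesis by (simp add: C_def)
qed

definition cyclic_triples :: "('a \<times> 'a) set \<Rightarrow> ('a \<times> 'a \<times> 'a) set" where
  "cyclic_triples R = {(u, v, w). (u, v) \<in> R \<and> (v, w) \<in> R \<and> (w, u) \<in> R}"

definition tournament_rel :: "'a set \<Rightarrow> ('a \<times> 'a) set \<Rightarrow> bool" where
  "tournament_rel V R \<longleftrightarrow> finite V \<and> R \<subseteq> V \<times> V \<and> irrefl R \<and>
    (\<forall>u\<in>V. \<forall>v\<in>V. u \<noteq> v \<longrightarrow> (u, v) \<in> R \<longleftrightarrow> (v, u) \<notin> R)"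

lemma tournament_rel_adjacency:
  assumes "tournament_rel V R" "u \<in> V" "v \<in> V"
  shows "of_bool ((u, v) \<in> R) + of_bool ((v, u) \<in> R) = (of_bool (u \<noteq> v) :: int)"
proof (cases "u = v")
  case True
  then show ?thesis using assms(1) by (simp add: tournament_rel_def irrefl_def)
next
  case False
  then have "(u, v) \<in> R \<longleftrightarrow> (v, u) \<notin> R"
    using assms unfolding tournament_rel_def by blast
  then show ?thesis using False by (cases "(v, u) \<in> R") simp_all
qed

lemma card_out_sum:
  assumes "tournament_rel V R"
  shows "int (card {v. (u, v) \<in> R}) = (\<Sum>v\<in>V. of_bool ((u, v) \<in> R))"
proof -
  have "{v. (u, v) \<in> R} = V \<inter> {v. (u, v) \<in> R}"
    using assms by (auto simp: tournament_rel_def)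
  then show ?thesis
    using assms by (simp add: tournament_rel_def)
qed

lemma card_in_sum:
  assumes "tournament_rel V R"
  shows "int (card {u. (u, v) \<in> R}) = (\<Sum>u\<in>V. of_bool ((u, v) \<in> R))"
proof -
  have "{u. (u, v) \<in> R} = V \<inter> {u. (u, v) \<in> R}"
    using assms by (auto simp: tournament_rel_def)
  then show ?thesis
    using assms by (simp add: tournament_rel_def)
qed

lemma card_cyclic_triples:
  assumes R: "tournament_rel V R"
  shows "8 * int (card (cyclic_triples R)) = int (card V) * ((int (card V))\<^sup>2 - 1)
    - 3 * (\<Sum>v\<in>V. (int (card {w. (v, w) \<in> R}) - int (card {u. (u, v) \<in> R}))\<^sup>2)"
proof -
  let ?a = "\<lambda>u v. of_bool ((u, v) \<in> R) :: int"
  have fin: "finite V" using R by (simp add: tournament_rel_def)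
  have sub: "cyclic_triples R = (V \<times> V \<times> V) \<inter> cyclic_triples R"
    using R by (auto simp: tournament_rel_def cyclic_triples_def)
  have "int (card (cyclic_triples R)) = (\<Sum>x\<in>V \<times> V \<times> V. of_bool (x \<in> cyclic_triples R))"
    by (subst sub) (simp add: fin)
  also have "\<dots> = (\<Sum>u\<in>V. \<Sum>v\<in>V. \<Sum>w\<in>V. ?a u v * ?a v w * ?a w u)"
    unfolding sum.cartesian_product by (intro sum.cong) (auto simp: cyclic_triples_def)
  finally have "8 * int (card (cyclic_triples R))
      = 8 * (\<Sum>u\<in>V. \<Sum>v\<in>V. \<Sum>w\<in>V. ?a u v * ?a v w * ?a w u)" by simp
  also have "\<dots> = int (card V) * ((int (card V))\<^sup>2 - 1)
      - 3 * (\<Sum>v\<in>V. ((\<Sum>w\<in>V. ?a v w) - (\<Sum>u\<in>V. ?a u v))\<^sup>2)"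
    by (rule sum_cyclic_products[OF fin]) (use tournament_rel_adjacency[OF R] in auto)
  finally show ?thesis
    by (simp only: card_out_sum[OF R] card_in_sum[OF R])
qed

lemma card_tournament_rel:
  assumes R: "tournament_rel V R"
  shows "2 * int (card R) = int (card V) * (int (card V) - 1)"
proof -
  let ?a = "\<lambda>u v. of_bool ((u, v) \<in> R) :: int"
  have fin: "finite V" using R by (simp add: tournament_rel_def)
  have sub: "R = (V \<times> V) \<inter> R" using R by (auto simp: tournament_rel_def)
  have "int (card R) = (\<Sum>x\<in>V \<times> V. of_bool (x \<in> R))"
    by (subst sub) (simp add: fin)
  also have "\<dots> = (\<Sum>u\<in>V. \<Sum>v\<in>V. ?a u v)"
    unfolding sum.cartesian_product by (intro sum.cong) auto
  finally have 1: "int (card R) = (\<Sum>u\<in>V. \<Sum>v\<in>V. ?a u v)" .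
  then have 2: "int (card R) = (\<Sum>u\<in>V. \<Sum>v\<in>V. ?a v u)"
    by (subst sum.swap)
  have "2 * int (card R) = (\<Sum>u\<in>V. \<Sum>v\<in>V. ?a u v + ?a v u)"
    unfolding sum.distrib using 1 2 by linarith
  also have "\<dots> = (\<Sum>u\<in>V. \<Sum>v\<in>V. 1 - (if v = u then 1 else 0))"
    by (intro sum.cong refl) (auto simp: tournament_rel_adjacency[OF R])
  also have "\<dots> = int (card V) * (int (card V) - 1)"
    by (simp add: sum_subtractf fin algebra_simps)
  finally show ?thesis .
qed

section \<open>Sums of squares of balanced numbers\<close>

text \<open>The positive and the negative numbers contribute equally to the sum of the absolute values,
  and since the number of terms is odd, one of the two kinds occurs at most \<open>(card V - 1) / 2\<close>
  times. Hence the absolute values sum to at most \<open>(card V - 1) i\<close>, and each square is at most \<open>i\<close>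
  times the absolute value.\<close>

lemma sum_squares_le_odd:
  fixes e :: "'a \<Rightarrow> 'b :: linordered_idom"
  assumes fin: "finite V" and odd: "odd (card V)"
    and zero: "(\<Sum>v\<in>V. e v) = 0" and bound: "\<And>v. v \<in> V \<Longrightarrow> \<bar>e v\<bar> \<le> i"
  shows "(\<Sum>v\<in>V. (e v)\<^sup>2) \<le> (of_nat (card V) - 1) * i\<^sup>2"
proof -
  let ?P = "{v \<in> V. e v > 0}" and ?N = "{v \<in> V. e v < 0}"
  from odd have "V \<noteq> {}" by auto
  then have i: "i \<ge> 0" using bound abs_ge_zero order_trans by blast
  have le: "(\<Sum>v\<in>A. \<bar>e v\<bar>) \<le> of_nat (card A) * i" if "A \<subseteq> V" for A
    using that by (intro sum_bounded_above bound) auto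
  have abs_sum: "(\<Sum>v\<in>V. \<bar>e v\<bar>) = (\<Sum>v\<in>?P. \<bar>e v\<bar>) + (\<Sum>v\<in>?N. \<bar>e v\<bar>)"
    unfolding sum.inter_filter[OF fin] sum.distrib[symmetric] by (intro sum.cong) auto
  have "(\<Sum>v\<in>V. e v) = (\<Sum>v\<in>?P. \<bar>e v\<bar>) - (\<Sum>v\<in>?N. \<bar>e v\<bar>)"
    unfolding sum.inter_filter[OF fin] sum_subtractf[symmetric] by (intro sum.cong) auto
  then have balance: "(\<Sum>v\<in>?P. \<bar>e v\<bar>) = (\<Sum>v\<in>?N. \<bar>e v\<bar>)"
    unfolding zero by (rule iffD1[OF right_minus_eq, OF sym])
  have half: "(\<Sum>v\<in>V. \<bar>e v\<bar>) = 2 * (\<Sum>v\<in>?P. \<bar>e v\<bar>)" "(\<Sum>v\<in>V. \<bar>e v\<bar>) = 2 * (\<Sum>v\<in>?N. \<bar>e v\<bar>)"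
    unfolding abs_sum balance by (simp_all only: mult_2)
  have "card ?P + card ?N = card (?P \<union> ?N)"
    using fin by (subst card_Un_disjoint) auto
  also have "\<dots> \<le> card V" using fin by (intro card_mono) auto
  finally have "2 * card ?P \<le> card V - 1 \<or> 2 * card ?N \<le> card V - 1"
    using odd by presburger
  then obtain A where A: "A \<subseteq> V" "2 * card A \<le> card V - 1" "(\<Sum>v\<in>V. \<bar>e v\<bar>) = 2 * (\<Sum>v\<in>A. \<bar>e v\<bar>)"
    using half by (metis (no_types, lifting) mem_Collect_eq subsetI)
  have "(of_nat (2 * card A) :: 'b) \<le> of_nat (card V - 1)"
    using A(2) by (simp only: of_nat_le_iff)
  also have "\<dots> = of_nat (card V) - 1"
    using odd by (subst of_nat_diff) (auto simp: Suc_le_eq intro: Nat.gr0I)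
  finally have cardA: "(of_nat (2 * card A) :: 'b) \<le> of_nat (card V) - 1" .
  have "(\<Sum>v\<in>V. (e v)\<^sup>2) \<le> (\<Sum>v\<in>V. i * \<bar>e v\<bar>)"
  proof (rule sum_mono)
    fix v assume "v \<in> V"
    then have "\<bar>e v\<bar> * \<bar>e v\<bar> \<le> i * \<bar>e v\<bar>" by (intro mult_right_mono bound) auto
    then show "(e v)\<^sup>2 \<le> i * \<bar>e v\<bar>" by (simp add: power2_eq_square)
  qed
  also have "\<dots> = i * (2 * (\<Sum>v\<in>A. \<bar>e v\<bar>))"
    by (simp only: A(3) sum_distrib_left[symmetric])
  also have "\<dots> \<le> i * (2 * (of_nat (card A) * i))"
    by (intro mult_left_mono le A(1) i) auto
  also have "\<dots> = of_nat (2 * card A) * i\<^sup>2"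
    by (simp add: power2_eq_square algebra_simps)
  also have "\<dots> \<le> (of_nat (card V) - 1) * i\<^sup>2"
    by (rule mult_right_mono[OF cardA]) simp
  finally show ?thesis .
qed

section \<open>Triangles with two arcs of one colour\<close>

text \<open>Up to rotation, two arcs of equal colour of a cyclic triple are the first two, and for each
  choice of the second arc there are at most \<open>D\<close> choices of the first.\<close>

lemma card_cyclic_triples_le:
  fixes c :: "'a \<times> 'a \<Rightarrow> 'c"
  assumes fin: "finite R"
    and D: "\<And>v k. card {u. (u, v) \<in> R \<and> c (u, v) = k} \<le> D"
    and no_rainbow: "\<And>u v w. (u, v, w) \<in> cyclic_triples R \<Longrightarrow> \<not> distinct [c (u, v), c (v, w), c (w, u)]"
  shows "card (cyclic_triples R) \<le> 3 * (card R * D)"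
proof -
  define M where "M = {(u, v, w). (u, v) \<in> R \<and> (v, w) \<in> R \<and> c (u, v) = c (v, w)}"
  define rot :: "'a \<times> 'a \<times> 'a \<Rightarrow> 'a \<times> 'a \<times> 'a" where "rot = (\<lambda>(u, v, w). (v, w, u))"
  let ?S = "SIGMA x:R. {u. (u, fst x) \<in> R \<and> c (u, fst x) = c x}"
  have fin_in: "finite {u. (u, v) \<in> R \<and> c (u, v) = k}" for v k
    by (rule finite_subset[of _ "fst ` R"]) (force simp: fin)+
  have "card M \<le> card ?S"
  proof (rule surj_card_le)
    show "finite ?S" using fin fin_in by auto
    show "M \<subseteq> (\<lambda>((v, w), u). (u, v, w)) ` ?S" by (force simp: M_def image_iff)
  qed
  also have "\<dots> = (\<Sum>x\<in>R. card {u. (u, fst x) \<in> R \<and> c (u, fst x) = c x})"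
    using fin fin_in by (intro card_SigmaI) auto
  also have "\<dots> \<le> card R * D"
    using sum_bounded_above[of R "\<lambda>x. card {u. (u, fst x) \<in> R \<and> c (u, fst x) = c x}" D] D by simp
  finally have M: "card M \<le> card R * D" .
  have finM: "finite M"
  proof (rule finite_subset)
    show "M \<subseteq> fst ` R \<times> R" by (force simp: M_def)
  qed (simp add: fin)
  have "cyclic_triples R \<subseteq> M \<union> (rot ` M \<union> rot ` rot ` M)"
  proof
    fix x assume x: "x \<in> cyclic_triples R"
    obtain u v w where uvw: "x = (u, v, w)" by (cases x)
    have rot: "rot (w, u, v) = x" "rot (rot (v, w, u)) = x" by (simp_all add: uvw rot_def)
    have "(u, v, w) \<in> M \<or> (w, u, v) \<in> M \<or> (v, w, u) \<in> M"
      using x no_rainbow[of u v w] by (auto simp: uvw M_def cyclic_triples_def)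
    then show "x \<in> M \<union> (rot ` M \<union> rot ` rot ` M)"
      using imageI[of "(w, u, v)" M rot] imageI[OF imageI[of "(v, w, u)" M rot], of rot]
      by (auto simp only: rot uvw[symmetric] Un_iff)
  qed
  then have "card (cyclic_triples R) \<le> card (M \<union> (rot ` M \<union> rot ` rot ` M))"
    by (intro card_mono) (simp_all add: finM)
  also have "\<dots> \<le> card M + (card (rot ` M) + card (rot ` rot ` M))"
    by (meson add_left_mono card_Un_le le_trans)
  also have "\<dots> \<le> card M + (card M + card M)"
    by (intro add_mono order_refl card_image_le order_trans[OF card_image_le card_image_le])
      (simp_all add: finM)
  finally show ?thesis using M by simp
qed

section \<open>Arcs as ordered pairs of vertices\<close>

context tournament
begin

lemma tournament_rel_arcs_ends: "tournament_rel (verts G) (arcs_ends G)"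
  unfolding tournament_rel_def
proof (intro conjI ballI impI)
  show "arcs_ends G \<subseteq> verts G \<times> verts G" "irrefl (arcs_ends G)"
    using no_loops by (auto simp: arcs_ends_conv irrefl_def)
next
  fix u v assume uv: "u \<in> verts G" "v \<in> verts G" "u \<noteq> v"
  from ex1_arc[OF uv] obtain e where e: "e \<in> arcs G" "{tail G e, head G e} = {u, v}"
    and uniq: "\<And>e'. e' \<in> arcs G \<Longrightarrow> {tail G e', head G e'} = {u, v} \<Longrightarrow> e' = e" by blast
  show "(u, v) \<in> arcs_ends G \<longleftrightarrow> (v, u) \<notin> arcs_ends G"
  proof
    assume "(u, v) \<in> arcs_ends G"
    then obtain e1 where e1: "e1 \<in> arcs G" "tail G e1 = u" "head G e1 = v"
      by (auto simp: arcs_ends_conv)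
    then have "e1 = e" by (intro uniq) auto
    show "(v, u) \<notin> arcs_ends G"
    proof
      assume "(v, u) \<in> arcs_ends G"
      then obtain e2 where e2: "e2 \<in> arcs G" "tail G e2 = v" "head G e2 = u"
        by (auto simp: arcs_ends_conv)
      then have "e2 = e" by (intro uniq) auto
      with \<open>e1 = e\<close> e1 e2 uv show False by simp
    qed
  next
    assume "(v, u) \<notin> arcs_ends G"
    with e show "(u, v) \<in> arcs_ends G"
      by (auto simp: arcs_ends_conv doubleton_eq_iff)
  qed
qed simp

definition arc_of :: "'a \<times> 'a \<Rightarrow> 'b" where
  "arc_of = the_inv_into (arcs G) (arc_to_ends G)"

lemma arc_of:
  assumes "(u, v) \<in> arcs_ends G"
  shows "arc_of (u, v) \<in> arcs G" "tail G (arc_of (u, v)) = u" "head G (arc_of (u, v)) = v"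
proof -
  have "arc_of (u, v) \<in> arcs G \<and> arc_to_ends G (arc_of (u, v)) = (u, v)"
    using assms the_inv_into_into[OF inj_on_arc_to_ends _ order_refl]
      f_the_inv_into_f[OF inj_on_arc_to_ends]
    by (auto simp: arc_of_def arcs_ends_def)
  then show "arc_of (u, v) \<in> arcs G" "tail G (arc_of (u, v)) = u" "head G (arc_of (u, v)) = v"
    by (auto simp: arc_to_ends_def)
qed

lemma arc_of_ends: "e \<in> arcs G \<Longrightarrow> arc_of (tail G e, head G e) = e"
  using the_inv_into_f_f[OF inj_on_arc_to_ends] by (simp add: arc_of_def arc_to_ends_def)

lemma card_in_arcs_filter:
  "card {u. (u, v) \<in> arcs_ends G \<and> P (arc_of (u, v))} = card {e \<in> in_arcs G v. P e}"
proof (rule bij_betw_same_card)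
  show "bij_betw (\<lambda>u. arc_of (u, v)) {u. (u, v) \<in> arcs_ends G \<and> P (arc_of (u, v))}
      {e \<in> in_arcs G v. P e}"
    by (rule bij_betw_byWitness[where f' = "tail G"])
      (auto simp: arc_of arc_of_ends arcs_ends_conv)
qed

lemma card_out_arcs_filter:
  "card {v. (u, v) \<in> arcs_ends G \<and> P (arc_of (u, v))} = card {e \<in> out_arcs G u. P e}"
proof (rule bij_betw_same_card)
  show "bij_betw (\<lambda>v. arc_of (u, v)) {v. (u, v) \<in> arcs_ends G \<and> P (arc_of (u, v))}
      {e \<in> out_arcs G u. P e}"
    by (rule bij_betw_byWitness[where f' = "head G"])
      (auto simp: arc_of arc_of_ends arcs_ends_conv)
qed

lemma in_degree_eq: "in_degree G v = card {u. (u, v) \<in> arcs_ends G}"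
  using card_in_arcs_filter[of v "\<lambda>_. True"] by (simp add: in_degree_def in_arcs_def)

lemma out_degree_eq: "out_degree G u = card {v. (u, v) \<in> arcs_ends G}"
  using card_out_arcs_filter[of u "\<lambda>_. True"] by (simp add: out_degree_def out_arcs_def)

lemma abs_degree_diff_le_irregularity:
  assumes "v \<in> verts G"
  shows "\<bar>int (out_degree G v) - int (in_degree G v)\<bar> \<le> irregularity G"
  unfolding irregularity_def using assms by (intro Max_ge) auto

lemma card_mono_in_arcs_le:
  assumes "v \<in> verts G"
  shows "card {e \<in> in_arcs G v. col e = k} \<le> max_mono_in G col"
  unfolding max_mono_in_def
proof (rule Max_ge)
  show "finite {card {e \<in> in_arcs G v. col e = k} |v k. v \<in> verts G}"
    by (rule finite_subset[of _ "{..card (arcs G)}"]) (auto intro!: card_mono)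
qed (use assms in blast)

lemma sum_degree_diff: "(\<Sum>v\<in>verts G. int (out_degree G v) - int (in_degree G v)) = 0"
  unfolding sum_subtractf in_degree_eq out_degree_eq
    card_out_sum[OF tournament_rel_arcs_ends] card_in_sum[OF tournament_rel_arcs_ends]
  by (subst sum.swap) simp

lemma dir_triangle_arc_of:
  assumes "(u, v, w) \<in> cyclic_triples (arcs_ends G)"
  shows "dir_triangle G [arc_of (u, v), arc_of (v, w), arc_of (w, u)]"
proof -
  have ends: "(u, v) \<in> arcs_ends G" "(v, w) \<in> arcs_ends G" "(w, u) \<in> arcs_ends G"
    using assms by (auto simp: cyclic_triples_def)
  then have "u \<noteq> v" "v \<noteq> w" "w \<noteq> u"
    using tournament_rel_arcs_ends by (auto simp: tournament_rel_def irrefl_def)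
  moreover have "u \<in> verts G" using ends tail_in_verts arc_of by metis
  ultimately show ?thesis
    using ends by (auto simp: dir_triangle_def cycle_def awalk_def arc_of intro!: exI[of _ u])
qed

text \<open>Both counts of cyclic triples, multiplied by 8 to clear denominators. The colour of a pair of
  vertices is that of the arc joining them.\<close>

lemma degree_diff_bound_no_rainbow:
  assumes no: "\<not> (\<exists>p. dir_triangle G p \<and> rainbow col p)"
  defines "n \<equiv> int (card (verts G))"
  shows "n * (n\<^sup>2 - 1) - 3 * (\<Sum>v\<in>verts G. (int (out_degree G v) - int (in_degree G v))\<^sup>2)
    \<le> 12 * int (max_mono_in G col) * (n * (n - 1))"
proof -
  note R = tournament_rel_arcs_ends
  have "card (cyclic_triples (arcs_ends G)) \<le> 3 * (card (arcs_ends G) * max_mono_in G col)"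
  proof (rule card_cyclic_triples_le[where c = "\<lambda>x. col (arc_of x)"])
    show "finite (arcs_ends G)" by (simp add: arcs_ends_def)
    show "card {u. (u, v) \<in> arcs_ends G \<and> col (arc_of (u, v)) = k} \<le> max_mono_in G col" for v k
    proof (cases "v \<in> verts G")
      case True
      then show ?thesis
        using card_in_arcs_filter[of v "\<lambda>e. col e = k"] card_mono_in_arcs_le by simp
    next
      case False
      then have "{u. (u, v) \<in> arcs_ends G \<and> col (arc_of (u, v)) = k} = {}"
        by (auto simp: arcs_ends_conv)
      then show ?thesis by (simp only: card.empty)
    qed
    show "\<not> distinct [col (arc_of (u, v)), col (arc_of (v, w)), col (arc_of (w, u))]"
      if "(u, v, w) \<in> cyclic_triples (arcs_ends G)" for u v w
    proof
      assume "distinct [col (arc_of (u, v)), col (arc_of (v, w)), col (arc_of (w, u))]"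
      then have "rainbow col [arc_of (u, v), arc_of (v, w), arc_of (w, u)]"
        by (simp add: rainbow_def)
      with no dir_triangle_arc_of[OF that] show False by blast
    qed
  qed
  then have "8 * int (card (cyclic_triples (arcs_ends G)))
      \<le> 12 * int (max_mono_in G col) * (2 * int (card (arcs_ends G)))"
    by (simp add: algebra_simps flip: of_nat_mult)
  then show ?thesis
    unfolding card_cyclic_triples[OF R] card_tournament_rel[OF R] n_def in_degree_eq out_degree_eq .
qed

end

section \<open>Rainbow triangles\<close>

theorem theorem3:
  fixes T :: "('a, 'b) pre_digraph" and col :: "'b \<Rightarrow> nat" and n :: nat
  assumes "tournament T"
    and "card (verts T) = n"
    and "n \<ge> 2"
    and "strongly_connected T"
    and "max_mono_in T col \<le> max_mono_out T col"
    and "(odd n \<and> real (max_mono_in T col)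
            < ((real n)\<^sup>2 + real n - 3 * (real_of_int (irregularity T))\<^sup>2) / (12 * real n))
       \<or> (even n \<and> real (max_mono_in T col)
            < ((real n)\<^sup>2 - 1 - 3 * (real_of_int (irregularity T))\<^sup>2) / (12 * (real n - 1)))"
  shows "\<exists>p. dir_triangle T p \<and> rainbow col p"
proof (rule ccontr)
  assume no: "\<not> ?thesis"
  interpret tournament T by fact
  define e where "e v = int (out_degree T v) - int (in_degree T v)" for v
  define S where "S = real_of_int (\<Sum>v\<in>verts T. (e v)\<^sup>2)"
  define x D i where "x = real n" and "D = real (max_mono_in T col)"
    and "i = real_of_int (irregularity T)"
  have x: "x \<ge> 2" using assms(3) by (simp add: x_def)
  have bound: "\<bar>e v\<bar> \<le> irregularity T" if "v \<in> verts T" for v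
    using abs_degree_diff_le_irregularity[OF that] by (simp add: e_def)
  have "real_of_int (int n * ((int n)\<^sup>2 - 1) - 3 * (\<Sum>v\<in>verts T. (e v)\<^sup>2))
      \<le> real_of_int (12 * int (max_mono_in T col) * (int n * (int n - 1)))"
    unfolding of_int_le_iff using degree_diff_bound_no_rainbow[OF no] assms(2) by (simp add: e_def)
  then have count: "x * (x\<^sup>2 - 1) - 3 * S \<le> 12 * D * (x * (x - 1))"
    by (simp add: S_def x_def D_def)
  show False
  proof (cases "odd n")
    case True
    have "(\<Sum>v\<in>verts T. (e v)\<^sup>2) \<le> (int (card (verts T)) - 1) * (irregularity T)\<^sup>2"
      using True assms(2) sum_degree_diff bound by (intro sum_squares_le_odd) (auto simp: e_def)
    then have "S \<le> real_of_int ((int n - 1) * (irregularity T)\<^sup>2)"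
      unfolding S_def of_int_le_iff by (simp add: assms(2))
    then have "S \<le> (x - 1) * i\<^sup>2" by (simp add: x_def i_def)
    with count have "(x - 1) * (x\<^sup>2 + x - 3 * i\<^sup>2) \<le> (x - 1) * (D * (12 * x))"
      by (simp add: power2_eq_square algebra_simps)
    with x have "x\<^sup>2 + x - 3 * i\<^sup>2 \<le> D * (12 * x)"
      by simp
    moreover have "D < (x\<^sup>2 + x - 3 * i\<^sup>2) / (12 * x)"
      using assms(6) True by (simp add: D_def x_def i_def)
    ultimately show False
      using x by (simp add: pos_less_divide_eq)
  next
    case False
    have "(e v)\<^sup>2 \<le> (irregularity T)\<^sup>2" if "v \<in> verts T" for v
      using power_mono[OF bound[OF that], of 2] by simp
    then have "(\<Sum>v\<in>verts T. (e v)\<^sup>2) \<le> int (card (verts T)) * (irregularity T)\<^sup>2"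
      by (rule sum_bounded_above)
    then have "S \<le> real_of_int (int n * (irregularity T)\<^sup>2)"
      unfolding S_def of_int_le_iff by (simp add: assms(2))
    then have "S \<le> x * i\<^sup>2" by (simp add: x_def i_def)
    with count have "x * (x\<^sup>2 - 1 - 3 * i\<^sup>2) \<le> x * (D * (12 * (x - 1)))"
      by (simp add: power2_eq_square algebra_simps)
    with x have "x\<^sup>2 - 1 - 3 * i\<^sup>2 \<le> D * (12 * (x - 1))"
      by simp
    moreover have "D < (x\<^sup>2 - 1 - 3 * i\<^sup>2) / (12 * (x - 1))"
      using assms(6) False by (simp add: D_def x_def i_def)
    ultimately show False
      using x by (simp add: pos_less_divide_eq)
  qed
qed

end
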